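(* If $f\colon X\to Y$ is a Lipschitz function of metric spaces, then $\dim_{AN}(X)\le \dim_{AN}(f)+\dim_{AN}(Y)$.
   Context: For a metric space $X$, $n\ge0$: an $n$-dimensional control function of $X$ is $D_X\colon\mathbb R_+\to\mathbb R_+$ such that for each $r>0$ there are families $\mathcal U_1,\dots,\mathcal U_{n+1}$ of subsets of $X$, each $r$-disjoint (points in different members at distance $\ge r$), with members of diameter $\le D_X(r)$, whose union covers $X$. $\dim_{AN}(X)\le n$ iff $X$ has an $n$-dimensional control function of the form $D_X(r)=cr$ for some $c>0$. For $r>0$, the $r$-components of $A\subset X$ are the classes of points of $A$ joined by finite sequences in $A$ with consecutive distances $\le r$. An $m$-dimensional control function of $f\colon X\to Y$ is $D_f\colon\mathbb R_+\times\mathbb R_+\to\mathbb R_+$ such that for all $r_X,R_Y>0$ every $A\subset X$ with $\operatorname{diam} f(A)\le R_Y$ is a union of $m+1$ sets whose $r_X$-components have diameter $\le D_f(r_X,R_Y)$. $\dim_{AN}(f)$ is the minimal $m$ for which $f$ has an $m$-dimensional control function of the form $D_f(r_X,R_Y)=a r_X+bR_Y$ (constants $a,b$). *)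

theory Defs
  imports "HOL-Analysis.Analysis" "HOL-Library.Extended_Nat"
begin

definition diam_le :: "'a::metric_space set \<Rightarrow> real \<Rightarrow> bool" where
  "diam_le A D \<longleftrightarrow> (\<forall>x\<in>A. \<forall>y\<in>A. dist x y \<le> D)"

definition r_disjoint :: "real \<Rightarrow> 'a::metric_space set set \<Rightarrow> bool" where
  "r_disjoint r U \<longleftrightarrow>
     (\<forall>A\<in>U. \<forall>B\<in>U. A \<noteq> B \<longrightarrow> (\<forall>x\<in>A. \<forall>y\<in>B. r \<le> dist x y))"

definition space_control_function :: "nat \<Rightarrow> (real \<Rightarrow> real) \<Rightarrow> 'a::metric_space itself \<Rightarrow> bool" where
  "space_control_function n D _ \<longleftrightarrow>
     (\<forall>r>0. \<exists>U :: nat \<Rightarrow> 'a set set.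
        (\<forall>i\<le>n. r_disjoint r (U i) \<and> (\<forall>A\<in>U i. diam_le A (D r))) \<and>
        (\<Union>i\<le>n. \<Union>(U i)) = UNIV)"

definition asdim_space :: "'a::metric_space itself \<Rightarrow> enat" where
  "asdim_space T = Inf {enat n | n. \<exists>c>0. space_control_function n (\<lambda>r. c * r) T}"

definition r_component :: "'a::metric_space set \<Rightarrow> real \<Rightarrow> 'a \<Rightarrow> 'a set" where
  "r_component A r x = {y. (x, y) \<in> {(a, b). a \<in> A \<and> b \<in> A \<and> dist a b \<le> r}\<^sup>*} \<inter> A"

definition map_control_function ::
    "nat \<Rightarrow> (real \<Rightarrow> real \<Rightarrow> real) \<Rightarrow> ('a::metric_space \<Rightarrow> 'b::metric_space) \<Rightarrow> bool" where
  "map_control_function m D f \<longleftrightarrow>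
     (\<forall>rX>0. \<forall>RY>0. \<forall>A :: 'a set. diam_le (f ` A) RY \<longrightarrow>
        (\<exists>B :: nat \<Rightarrow> 'a set. A = (\<Union>i\<le>m. B i) \<and>
           (\<forall>i\<le>m. \<forall>x\<in>B i. diam_le (r_component (B i) rX x) (D rX RY))))"

definition asdim_map :: "('a::metric_space \<Rightarrow> 'b::metric_space) \<Rightarrow> enat" where
  "asdim_map f = Inf {enat m | m. \<exists>a b. 0 \<le> a \<and> 0 \<le> b \<and>
                        map_control_function m (\<lambda>rX RY. a * rX + b * RY) f}"

end

theory Submission
  imports Defs
begin

text \<open>
  Kolmogorov's trick turns an \<open>n\<close>-dimensional decomposition into \<open>m + n + 1\<close> sets with bounded
  components such that every point lies in \<open>m + 1\<close> of them. Apply it to \<open>Y\<close> at scale about \<open>r\<close>,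
  obtaining sets \<open>A i\<close> with components of diameter at most \<open>R\<close>. Next cover \<open>Y\<close> by \<open>n + 1\<close> families
  that are \<open>(R + r)\<close>-disjoint and bounded, and apply the trick to the preimage of every member \<open>C\<close>,
  obtaining \<open>m + n + 1\<close> sets covering each point \<open>n + 1\<close> times, where the scale \<open>\<sigma> t\<close> depends on the
  family \<open>t\<close> of \<open>C\<close> and \<open>\<sigma> (t + 1)\<close> exceeds the bounds obtained for \<open>\<sigma> 0, \<dots>, \<sigma> t\<close>. Let \<open>Z i\<close> be the
  union of the \<open>i\<close>-th sets over all \<open>C\<close>. By counting, the sets \<open>Z i \<inter> f -` A i\<close> cover \<open>X\<close>. A
  component of \<open>A i\<close> meets at most one member of each family, so over it \<open>Z i\<close> is a union of
  \<open>n + 1\<close> sets with components bounded at rapidly increasing scales, and such a union again has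
  bounded components.
\<close>

section \<open>Chains and sets with bounded components\<close>

definition linked :: "real \<Rightarrow> 'a::metric_space set \<Rightarrow> ('a \<times> 'a) set" where
  "linked r A = {(a, b). a \<in> A \<and> b \<in> A \<and> dist a b \<le> r}"

text \<open>Bounding the distance between the ends of a chain suits induction on
  \<open>rtrancl\<close>; \<open>comp_bounded_iff_r_component\<close> identifies this with the
  diameter bound on \<open>r\<close>-components.\<close>

definition comp_bounded :: "real \<Rightarrow> real \<Rightarrow> 'a::metric_space set \<Rightarrow> bool" where
  "comp_bounded r D A \<longleftrightarrow> (\<forall>x\<in>A. \<forall>y. (x, y) \<in> (linked r A)\<^sup>* \<longrightarrow> dist x y \<le> D)"

lemma r_component_eq: "r_component A r x = {y. (x, y) \<in> (linked r A)\<^sup>*} \<inter> A"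
  by (simp add: r_component_def linked_def)

lemma linked_mono: "r \<le> r' \<Longrightarrow> A \<subseteq> A' \<Longrightarrow> linked r A \<subseteq> linked r' A'"
  by (auto simp: linked_def)

lemma linked_rtrancl_mono:
  "(x, y) \<in> (linked r A)\<^sup>* \<Longrightarrow> r \<le> r' \<Longrightarrow> A \<subseteq> A' \<Longrightarrow> (x, y) \<in> (linked r' A')\<^sup>*"
  by (rule subsetD[OF rtrancl_mono[OF linked_mono]])

lemma linked_rtrancl_in: "(x, y) \<in> (linked r A)\<^sup>* \<Longrightarrow> x \<in> A \<Longrightarrow> y \<in> A"
  by (induction rule: rtrancl_induct) (auto simp: linked_def)

lemma linked_rtrancl_sym: "(x, y) \<in> (linked r A)\<^sup>* \<Longrightarrow> (y, x) \<in> (linked r A)\<^sup>*"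
proof -
  have "sym (linked r A)"
    by (auto simp: linked_def sym_def dist_commute)
  then show "(x, y) \<in> (linked r A)\<^sup>* \<Longrightarrow> (y, x) \<in> (linked r A)\<^sup>*"
    by (meson sym_rtrancl symD)
qed

lemma comp_boundedD: "comp_bounded r D A \<Longrightarrow> x \<in> A \<Longrightarrow> (x, y) \<in> (linked r A)\<^sup>* \<Longrightarrow> dist x y \<le> D"
  by (auto simp: comp_bounded_def)

lemma comp_bounded_mono:
  assumes "comp_bounded r D A" "r' \<le> r" "D \<le> D'" "A' \<subseteq> A"
  shows "comp_bounded r' D' A'"
  unfolding comp_bounded_def
proof (intro ballI allI impI)
  fix x y assume x: "x \<in> A'" and xy: "(x, y) \<in> (linked r' A')\<^sup>*"
  have "dist x y \<le> D"
    using comp_boundedD[OF assms(1) _ linked_rtrancl_mono[OF xy assms(2,4)]] x assms(4) by blast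
  with assms(3) show "dist x y \<le> D'"
    by simp
qed

lemma comp_bounded_empty [simp]: "comp_bounded r D {}"
  by (simp add: comp_bounded_def)

lemma comp_bounded_iff_r_component:
  "comp_bounded r D A \<longleftrightarrow> (\<forall>x\<in>A. diam_le (r_component A r x) D)"
proof
  assume *: "comp_bounded r D A"
  show "\<forall>x\<in>A. diam_le (r_component A r x) D"
    unfolding diam_le_def
  proof (intro ballI)
    fix x y z
    assume "y \<in> r_component A r x" "z \<in> r_component A r x"
    then have y: "y \<in> A" and xy: "(x, y) \<in> (linked r A)\<^sup>*" and xz: "(x, z) \<in> (linked r A)\<^sup>*"
      by (simp_all add: r_component_eq)
    from linked_rtrancl_sym[OF xy] xz have "(y, z) \<in> (linked r A)\<^sup>*"
      by (rule rtrancl_trans)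
    with * y show "dist y z \<le> D"
      by (rule comp_boundedD)
  qed
next
  assume *: "\<forall>x\<in>A. diam_le (r_component A r x) D"
  show "comp_bounded r D A"
    unfolding comp_bounded_def
  proof (intro ballI allI impI)
    fix x y assume "x \<in> A" "(x, y) \<in> (linked r A)\<^sup>*"
    moreover from this have "y \<in> A"
      using linked_rtrancl_in by metis
    ultimately show "dist x y \<le> D"
      using * by (simp add: diam_le_def r_component_eq)
  qed
qed

text \<open>Points at distance below \<open>r\<close> are linked, so their components
  coincide.\<close>

lemma r_disjoint_r_components: "r_disjoint r (r_component A r ` A)"
  unfolding r_disjoint_def
proof (clarify)
  fix x x' y y'
  assume ne: "r_component A r x \<noteq> r_component A r x'"
    and y: "y \<in> r_component A r x" "y' \<in> r_component A r x'"
  show "r \<le> dist y y'"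
  proof (rule ccontr)
    assume "\<not> r \<le> dist y y'"
    then have yy: "(y, y') \<in> linked r A"
      using y by (auto simp: linked_def r_component_eq)
    have "(x, y) \<in> (linked r A)\<^sup>*" "(y', x') \<in> (linked r A)\<^sup>*"
      using y by (auto simp: r_component_eq intro: linked_rtrancl_sym)
    with yy have "(x, x') \<in> (linked r A)\<^sup>*"
      by (meson rtrancl_into_rtrancl rtrancl_trans)
    then have "r_component A r x = r_component A r x'"
      unfolding r_component_eq using linked_rtrancl_sym by (blast intro: rtrancl_trans)
    with ne show False ..
  qed
qed

text \<open>The \<open>r\<close>-components of the \<open>X i\<close> form the required families, so
  it suffices to construct sets with bounded components.\<close>

lemma space_control_functionI:
  assumes "\<And>r. r > 0 \<Longrightarrow> \<exists>X :: nat \<Rightarrow> 'a::metric_space set.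
      (\<forall>i\<le>n. comp_bounded r (D r) (X i)) \<and> (\<Union>i\<le>n. X i) = UNIV"
  shows "space_control_function n D TYPE('a)"
  unfolding space_control_function_def
proof (intro allI impI)
  fix r :: real assume "r > 0"
  then obtain X :: "nat \<Rightarrow> 'a set"
    where X: "\<And>i. i \<le> n \<Longrightarrow> comp_bounded r (D r) (X i)" "(\<Union>i\<le>n. X i) = UNIV"
    using assms[OF \<open>r > 0\<close>] by blast
  have "x \<in> r_component A r x" "r_component A r x \<subseteq> A" if "x \<in> A" for A :: "'a set" and x
    using that by (auto simp: r_component_eq)
  then have "\<Union> (r_component A r ` A) = A" for A :: "'a set"
    by blast
  moreover have "diam_le B (D r)" if "i \<le> n" "B \<in> r_component (X i) r ` X i" for i B
    using X(1)[OF that(1)] that(2) unfolding comp_bounded_iff_r_component by blast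
  ultimately show "\<exists>U :: nat \<Rightarrow> 'a set set.
        (\<forall>i\<le>n. r_disjoint r (U i) \<and> (\<forall>A\<in>U i. diam_le A (D r))) \<and> (\<Union>i\<le>n. \<Union> (U i)) = UNIV"
    using X(2) r_disjoint_r_components
    by (intro exI[of _ "\<lambda>i. r_component (X i) r ` X i"] conjI allI impI ballI) simp_all
qed

text \<open>A step shorter than \<open>r\<close> cannot pass between members, so a chain stays in
  the member where it starts. Strictness matters, as distinct members may be at distance exactly
  \<open>r\<close>.\<close>

lemma comp_bounded_Union_r_disjoint:
  assumes "r_disjoint r U" "\<And>A. A \<in> U \<Longrightarrow> diam_le A D" "r' < r"
  shows "comp_bounded r' D (\<Union>U)"
  unfolding comp_bounded_def
proof (intro ballI allI impI)
  fix x y assume "x \<in> \<Union>U" and xy: "(x, y) \<in> (linked r' (\<Union>U))\<^sup>*"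
  then obtain A where A: "A \<in> U" "x \<in> A" by blast
  from xy have "y \<in> A"
  proof (induction rule: rtrancl_induct)
    case (step y z)
    then have "z \<in> \<Union>U" "dist y z < r"
      using \<open>r' < r\<close> by (simp_all add: linked_def)
    then obtain B where B: "B \<in> U" "z \<in> B" "dist y z < r"
      by blast
    have "A = B"
    proof (rule ccontr)
      assume "A \<noteq> B"
      then have "r \<le> dist y z"
        using assms(1) A(1) B(1,2) step.IH by (simp add: r_disjoint_def)
      with B show False by simp
    qed
    with B show ?case by simp
  qed (use A in auto)
  then show "dist x y \<le> D"
    using A assms(2) by (auto simp: diam_le_def)
qed

section \<open>Kolmogorov's trick\<close>

definition multi_cover :: "nat \<Rightarrow> nat \<Rightarrow> (nat \<Rightarrow> 'a set) \<Rightarrow> 'a set \<Rightarrow> bool" where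
  "multi_cover k p B A \<longleftrightarrow> (\<forall>i<k. B i \<subseteq> A) \<and> (\<forall>x\<in>A. p \<le> card {i. i < k \<and> x \<in> B i})"

text \<open>Replacing each point of an \<open>r\<close>-chain by a point of \<open>B\<close> within
  \<open>r\<close> gives a \<open>3 * r\<close>-chain in \<open>B\<close>; the two ends cost another
  \<open>2 * r\<close>.\<close>

lemma comp_bounded_nbhd:
  assumes "comp_bounded (3 * r) D B"
  shows "comp_bounded r (D + 2 * r) {x \<in> A. \<exists>y\<in>B. dist x y \<le> r}"
  unfolding comp_bounded_def
proof (intro ballI allI impI)
  let ?N = "{x \<in> A. \<exists>y\<in>B. dist x y \<le> r}"
  fix x y assume x: "x \<in> ?N" and xy: "(x, y) \<in> (linked r ?N)\<^sup>*"
  then obtain x' where x': "x' \<in> B" "dist x x' \<le> r" by blast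
  from xy have "\<exists>y'\<in>B. dist y y' \<le> r \<and> (x', y') \<in> (linked (3 * r) B)\<^sup>*"
  proof (induction rule: rtrancl_induct)
    case base
    then show ?case using x' by blast
  next
    case (step y z)
    then obtain y' where y': "y' \<in> B" "dist y y' \<le> r" "(x', y') \<in> (linked (3 * r) B)\<^sup>*"
      by blast
    obtain z' where z': "z' \<in> B" "dist z z' \<le> r" and "dist y z \<le> r"
      using step.hyps(2) by (auto simp: linked_def)
    then have "dist y' z' \<le> 3 * r"
      using y' dist_triangle[of y' z' y] dist_triangle[of y z' z] by (simp add: dist_commute)
    then have "(y', z') \<in> linked (3 * r) B"
      using y' z' by (simp add: linked_def)
    then show ?case
      using y'(3) z' by (blast intro: rtrancl_into_rtrancl)
  qed
  then obtain y' where y': "y' \<in> B" "dist y y' \<le> r" "dist x' y' \<le> D"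
    using assms comp_boundedD x'(1) by blast
  then show "dist x y \<le> D + 2 * r"
    using x' dist_triangle[of x y x'] dist_triangle[of x' y y'] by (simp add: dist_commute)
qed

text \<open>The old sets are replaced by their \<open>r\<close>-neighbourhoods, and the additional set consists of the
  points lying in exactly \<open>p\<close> of these; along an \<open>r\<close>-chain of such points the collection of old
  sets containing the point is constant.\<close>

lemma kolmogorov_step:
  fixes B :: "nat \<Rightarrow> 'a::metric_space set"
  assumes B: "multi_cover k p B A" "\<And>i. i < k \<Longrightarrow> comp_bounded (3 * r) D (B i)"
    and "p > 0" "r \<ge> 0"
  shows "\<exists>B'. multi_cover (Suc k) (Suc p) B' A \<and>
    (\<forall>i<Suc k. comp_bounded r (D + 2 * r) (B' i))"
proof -
  define N where "N i = {x \<in> A. \<exists>y\<in>B i. dist x y \<le> r}" for i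
  define I where "I x = {i. i < k \<and> x \<in> B i}" for x
  define J where "J x = {i. i < k \<and> x \<in> N i}" for x
  define E where "E = {x \<in> A. card (J x) = p}"
  define B' where "B' = N(k := E)"
  have fin: "finite (I x)" "finite (J x)" for x
    by (auto simp: I_def J_def)
  have IJ: "I x \<subseteq> J y" if "dist x y \<le> r" "y \<in> A" for x y
    using that by (force simp: I_def J_def N_def dist_commute)
  have cardI: "p \<le> card (I x)" if "x \<in> A" for x
    using B(1) that by (auto simp: multi_cover_def I_def)
  have EJ: "I x = J x" if "x \<in> E" for x
  proof (rule card_subset_eq)
    show "I x \<subseteq> J x"
      using that \<open>r \<ge> 0\<close> by (intro IJ) (auto simp: E_def)
    then show "card (I x) = card (J x)"
      using that cardI[of x] card_mono[OF fin(2), of "I x" x] by (auto simp: E_def)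
  qed (rule fin)
  \<comment> \<open>On \<open>E\<close> the sets \<open>I\<close> and \<open>J\<close> agree and
    have size \<open>p\<close>, so the inclusion of \<open>I x\<close> in \<open>J y\<close> is an
    equality.\<close>
  have const: "I y = I x" if "(x, y) \<in> linked r E" for x y
  proof -
    from that have xy: "x \<in> E" "y \<in> E" "dist x y \<le> r"
      by (auto simp: linked_def)
    then have "I x \<subseteq> J y"
      by (intro IJ) (auto simp: E_def)
    moreover have "card (I x) = card (J y)"
      using xy EJ by (simp add: E_def)
    ultimately have "I x = J y"
      using card_subset_eq fin by metis
    then show ?thesis
      using EJ xy by simp
  qed
  have E: "comp_bounded r (D + 2 * r) E"
    unfolding comp_bounded_def
  proof (intro ballI allI impI)
    fix x y assume x: "x \<in> E" and xy: "(x, y) \<in> (linked r E)\<^sup>*"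
    \<comment> \<open>Any old set containing \<open>x\<close> contains the whole chain, so its bound
      \<open>D\<close> carries over.\<close>
    have "I x \<noteq> {}"
      using x cardI[of x] \<open>p > 0\<close> by (auto simp: E_def)
    then obtain i where i: "i \<in> I x" by blast
    from xy have "(x, y) \<in> (linked (3 * r) (B i))\<^sup>* \<and> I y = I x"
    proof (induction rule: rtrancl_induct)
      case (step y z)
      then have Iz: "I z = I x" "I y = I x"
        using const[of y z] by auto
      then have "y \<in> B i" "z \<in> B i"
        using i unfolding I_def by blast+
      moreover have "dist y z \<le> 3 * r"
        using step.hyps(2) \<open>r \<ge> 0\<close> by (auto simp: linked_def)
      ultimately have "(y, z) \<in> linked (3 * r) (B i)"
        by (simp add: linked_def)
      with Iz(1) show ?case
        using rtrancl_into_rtrancl[OF conjunct1[OF step.IH]] by simp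
    qed simp
    then have "dist x y \<le> D"
      using i B(2) by (intro comp_boundedD[of "3 * r" D "B i"]) (auto simp: I_def)
    then show "dist x y \<le> D + 2 * r"
      using \<open>r \<ge> 0\<close> by simp
  qed
  \<comment> \<open>Either \<open>J x\<close> already has more than \<open>p\<close> elements, or
    \<open>x\<close> lies in \<open>E\<close> and gains the new index \<open>k\<close>.\<close>
  have "Suc p \<le> card {i. i < Suc k \<and> x \<in> B' i}" if x: "x \<in> A" for x
  proof -
    have sub: "I x \<subseteq> J x"
      using x \<open>r \<ge> 0\<close> by (intro IJ) auto
    have le: "p \<le> card (J x)"
      using cardI[OF x] card_mono[OF fin(2) sub] by simp
    have eq: "{i. i < Suc k \<and> x \<in> B' i} = J x \<union> (if x \<in> E then {k} else {})"
      by (auto simp: B'_def J_def less_Suc_eq)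
    have "k \<notin> J x"
      by (simp add: J_def)
    then show ?thesis
      using le x fin(2)[of x] unfolding eq by (auto simp: E_def)
  qed
  moreover have "B' i \<subseteq> A" for i
    by (auto simp: B'_def N_def E_def)
  moreover have "comp_bounded r (D + 2 * r) (B' i)" if "i < Suc k" for i
    using that E B(2) comp_bounded_nbhd[of r D "B i" A]
    by (auto simp: B'_def N_def less_Suc_eq)
  ultimately show ?thesis
    unfolding multi_cover_def by blast
qed

text \<open>Each of the \<open>j\<close> rounds divides the scale by 3; the added bounds sum to
  \<open>2 * r * (1 + 3 + ... + 3 ^ (j - 1)) = (3 ^ j - 1) * r\<close>.\<close>

lemma kolmogorov_trick:
  fixes B :: "nat \<Rightarrow> 'a::metric_space set"
  assumes "multi_cover k p B A" "\<And>i. i < k \<Longrightarrow> comp_bounded (3 ^ j * r) D (B i)"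
    and "p > 0" "r \<ge> 0"
  shows "\<exists>B'. multi_cover (k + j) (p + j) B' A \<and>
    (\<forall>i<k + j. comp_bounded r (D + (3 ^ j - 1) * r) (B' i))"
  using assms
proof (induction j arbitrary: r)
  case 0
  then show ?case by auto
next
  case (Suc j)
  then obtain B' where B': "multi_cover (k + j) (p + j) B' A"
    "\<And>i. i < k + j \<Longrightarrow> comp_bounded (3 * r) (D + (3 ^ j - 1) * (3 * r)) (B' i)"
    using Suc.IH[of "3 * r"] by (auto simp: mult.assoc mult.left_commute)
  have "D + (3 ^ j - 1) * (3 * r) + 2 * r = D + (3 ^ Suc j - 1) * r"
    by (simp add: algebra_simps)
  with kolmogorov_step[OF B'] Suc.prems(3,4) show ?case
    by simp
qed

lemma multi_cover_UN: "multi_cover (Suc m) (Suc 0) B (\<Union>i\<le>m. B i)"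
proof -
  have "Suc 0 \<le> card {i. i < Suc m \<and> x \<in> B i}" if "j \<le> m" "x \<in> B j" for x j
  proof -
    have "card {j} \<le> card {i. i < Suc m \<and> x \<in> B i}"
      using that by (intro card_mono) auto
    then show ?thesis by simp
  qed
  then show ?thesis
    by (auto simp: multi_cover_def less_Suc_eq_le)
qed

lemma space_control_function_multi_cover:
  assumes "space_control_function n (\<lambda>r. c * r) TYPE('a::metric_space)" and "r > 0"
  shows "\<exists>A :: nat \<Rightarrow> 'a set. multi_cover (Suc n + m) (Suc m) A UNIV \<and>
    (\<forall>i<Suc n + m. comp_bounded r ((2 * c + 1) * 3 ^ m * r) (A i))"
proof -
  \<comment> \<open>\<open>3 ^ m\<close> pays for \<open>m\<close> rounds of the trick; the factor 2
    keeps the scale \<open>3 ^ m * r\<close> strictly below \<open>\<rho>\<close>.\<close>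
  define \<rho> where "\<rho> = 2 * (3 ^ m * r)"
  have "\<rho> > 0" using assms by (simp add: \<rho>_def)
  then obtain U :: "nat \<Rightarrow> 'a set set"
    where U: "\<And>i. i \<le> n \<Longrightarrow> r_disjoint \<rho> (U i)"
      "\<And>i A. i \<le> n \<Longrightarrow> A \<in> U i \<Longrightarrow> diam_le A (c * \<rho>)"
      "(\<Union>i\<le>n. \<Union>(U i)) = UNIV"
    using assms(1) unfolding space_control_function_def by meson
  have 1: "multi_cover (Suc n) (Suc 0) (\<lambda>i. \<Union>(U i)) UNIV"
    using multi_cover_UN[of n "\<lambda>i. \<Union>(U i)"] U(3) by simp
  have 2: "comp_bounded (3 ^ m * r) (c * \<rho>) (\<Union>(U i))" if "i < Suc n" for i
    using that U(1)[of i] U(2)[of i] \<open>r > 0\<close>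
    by (intro comp_bounded_Union_r_disjoint[where r = \<rho>]) (simp_all add: \<rho>_def)
  have le: "c * \<rho> + (3 ^ m - 1) * r \<le> (2 * c + 1) * 3 ^ m * r"
    using \<open>r > 0\<close> by (simp add: \<rho>_def algebra_simps)
  from kolmogorov_trick[OF 1 2] \<open>r > 0\<close> obtain A :: "nat \<Rightarrow> 'a set"
    where "multi_cover (Suc n + m) (Suc 0 + m) A UNIV"
      "\<And>i. i < Suc n + m \<Longrightarrow> comp_bounded r (c * \<rho> + (3 ^ m - 1) * r) (A i)"
    by (auto simp del: add_Suc)
  then show ?thesis
    using comp_bounded_mono[OF _ order_refl le subset_refl] by (intro exI[of _ A]) auto
qed

text \<open>The \<open>n\<close> rounds of the trick change only the coefficient of
  \<open>r\<close>, so the bound stays linear in \<open>r\<close> and \<open>R\<close>.\<close>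

lemma map_control_function_multi_cover:
  fixes f :: "'a::metric_space \<Rightarrow> 'b::metric_space"
  assumes "map_control_function m (\<lambda>rX RY. a * rX + b * RY) f"
    and "diam_le C R" "R > 0" "r > 0"
  shows "\<exists>Z. multi_cover (Suc m + n) (Suc n) Z (f -` C) \<and>
    (\<forall>i<Suc m + n. comp_bounded r ((a + 1) * 3 ^ n * r + b * R) (Z i))"
proof -
  have "diam_le (f ` f -` C) R"
    using assms(2) by (auto simp: diam_le_def)
  moreover have "3 ^ n * r > 0" using assms by simp
  ultimately obtain B where B: "f -` C = (\<Union>i\<le>m. B i)"
    "\<forall>i\<le>m. \<forall>x\<in>B i. diam_le (r_component (B i) (3 ^ n * r) x) (a * (3 ^ n * r) + b * R)"
    using assms(1,3) unfolding map_control_function_def by meson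
  have 1: "multi_cover (Suc m) (Suc 0) B (f -` C)"
    using multi_cover_UN[of m B] B(1) by simp
  have 2: "comp_bounded (3 ^ n * r) (a * (3 ^ n * r) + b * R) (B i)" if "i < Suc m" for i
    using that B(2) by (simp add: comp_bounded_iff_r_component)
  have le: "a * (3 ^ n * r) + b * R + (3 ^ n - 1) * r \<le> (a + 1) * 3 ^ n * r + b * R"
    using \<open>r > 0\<close> by (simp add: algebra_simps)
  from kolmogorov_trick[OF 1 2] \<open>r > 0\<close> obtain Z
    where "multi_cover (Suc m + n) (Suc 0 + n) Z (f -` C)"
      "\<And>i. i < Suc m + n \<Longrightarrow> comp_bounded r (a * (3 ^ n * r) + b * R + (3 ^ n - 1) * r) (Z i)"
    by (auto simp del: add_Suc)
  then show ?thesis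
    using comp_bounded_mono[OF _ order_refl le subset_refl] by (intro exI[of _ Z]) auto
qed

section \<open>Unions with increasing scales\<close>

text \<open>An excursion into \<open>A\<close> between two visits to \<open>B\<close> moves by at
  most \<open>D\<close>, plus a step of \<open>r\<close> at each end. The visited points of
  \<open>B\<close> thus form a chain at scale \<open>D + 2 * r\<close>, and the initial and final
  excursions cost \<open>D + r\<close> each.\<close>

lemma comp_bounded_Un:
  assumes A: "comp_bounded r D A" and B: "comp_bounded (D + 2 * r) E B"
    and "D \<ge> 0" "E \<ge> 0" "r \<ge> 0"
  shows "comp_bounded r (E + 2 * (D + r)) (A \<union> B)"
  unfolding comp_bounded_def
proof (intro ballI allI impI)
  fix x y assume x: "x \<in> A \<union> B" and xy: "(x, y) \<in> (linked r (A \<union> B))\<^sup>*"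
  \<comment> \<open>Here \<open>b\<close> plays the last visited point of \<open>B\<close>, from
    which \<open>y\<close> is reached by at most one excursion into \<open>A\<close>.\<close>
  define near where
    "near y b \<longleftrightarrow> y = b \<or> (\<exists>a\<in>A. dist b a \<le> r \<and> (a, y) \<in> (linked r A)\<^sup>*)" for y b
  have near: "dist b y \<le> D + r" if "near y b" for y b
    using that unfolding near_def
  proof
    assume "\<exists>a\<in>A. dist b a \<le> r \<and> (a, y) \<in> (linked r A)\<^sup>*"
    then obtain a where "dist b a \<le> r" "dist a y \<le> D"
      using A comp_boundedD by blast
    then show ?thesis
      using dist_triangle[of b y a] by simp
  qed (use assms in auto)
  have next_B: "dist b z \<le> D + 2 * r" if "near y b" "dist y z \<le> r" for b y z
    using near[OF that(1)] that(2) dist_triangle[of b z y] by simp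
  \<comment> \<open>Invariant: either the chain has stayed in \<open>A\<close> so far, or
    \<open>b\<close> and \<open>b'\<close> are the first and last points at which it was counted in
    \<open>B\<close>.\<close>
  have "(x \<in> A \<and> (x, y) \<in> (linked r A)\<^sup>*) \<or>
    (\<exists>b\<in>B. \<exists>b'\<in>B. dist x b \<le> D + r \<and> (b, b') \<in> (linked (D + 2 * r) B)\<^sup>* \<and> near y b')"
    using xy
  proof (induction rule: rtrancl_induct)
    case base
    show ?case
    proof (cases "x \<in> A")
      case False
      then have "x \<in> B" "near x x" using x by (auto simp: near_def)
      then show ?thesis using assms by force
    qed simp
  next
    case (step y z)
    then have z: "z \<in> A \<or> z \<in> B" "dist y z \<le> r" by (auto simp: linked_def)
    from step.IH show ?case
    proof
      assume y: "x \<in> A \<and> (x, y) \<in> (linked r A)\<^sup>*"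
      then have yA: "y \<in> A" "dist x y \<le> D"
        using A comp_boundedD linked_rtrancl_in by blast+
      from z(1) show ?thesis
      proof
        assume "z \<in> A"
        then have "(y, z) \<in> linked r A" using yA z by (simp add: linked_def)
        with y show ?thesis by (meson rtrancl.rtrancl_into_rtrancl)
      next
        assume "z \<in> B"
        moreover have "dist x z \<le> D + r"
          using yA(2) z(2) dist_triangle[of x z y] by simp
        ultimately show ?thesis unfolding near_def by blast
      qed
    next
      assume "\<exists>b\<in>B. \<exists>b'\<in>B. dist x b \<le> D + r \<and> (b, b') \<in> (linked (D + 2 * r) B)\<^sup>* \<and> near y b'"
      then obtain b b' where b: "b \<in> B" "b' \<in> B" "dist x b \<le> D + r"
        "(b, b') \<in> (linked (D + 2 * r) B)\<^sup>*" "near y b'" by blast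
      from z(1) show ?thesis
      proof
        assume "z \<in> A"
        have "near z b'"
          using b(5) unfolding near_def
        proof
          assume "y = b'"
          then show "z = b' \<or> (\<exists>a\<in>A. dist b' a \<le> r \<and> (a, z) \<in> (linked r A)\<^sup>*)"
            using \<open>z \<in> A\<close> z(2) by blast
        next
          assume "\<exists>a\<in>A. dist b' a \<le> r \<and> (a, y) \<in> (linked r A)\<^sup>*"
          then obtain a where a: "a \<in> A" "dist b' a \<le> r" "(a, y) \<in> (linked r A)\<^sup>*" by blast
          then have "(y, z) \<in> linked r A"
            using \<open>z \<in> A\<close> z(2) linked_rtrancl_in by (fastforce simp: linked_def)
          with a show "z = b' \<or> (\<exists>a\<in>A. dist b' a \<le> r \<and> (a, z) \<in> (linked r A)\<^sup>*)"
            by (meson rtrancl.rtrancl_into_rtrancl)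
        qed
        with b show ?thesis by blast
      next
        assume "z \<in> B"
        then have "(b', z) \<in> linked (D + 2 * r) B"
          using next_B[OF b(5) z(2)] b(2) by (simp add: linked_def)
        then have "(b, z) \<in> (linked (D + 2 * r) B)\<^sup>*" "near z z"
          using b(4) by (auto simp: near_def)
        with b(1,3) \<open>z \<in> B\<close> show ?thesis by blast
      qed
    qed
  qed
  then show "dist x y \<le> E + 2 * (D + r)"
  proof
    assume "x \<in> A \<and> (x, y) \<in> (linked r A)\<^sup>*"
    then show ?thesis using A comp_boundedD assms(3-5) by fastforce
  next
    assume "\<exists>b\<in>B. \<exists>b'\<in>B. dist x b \<le> D + r \<and> (b, b') \<in> (linked (D + 2 * r) B)\<^sup>* \<and> near y b'"
    then obtain b b' where b: "dist x b \<le> D + r" "dist b b' \<le> E" "dist b' y \<le> D + r"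
      using near B comp_boundedD by blast
    then show ?thesis
      using dist_triangle[of x y b] dist_triangle[of b y b'] by simp
  qed
qed

text \<open>Each scale \<open>s (t + 1)\<close> is chosen above the bound that holds for the union of \<open>W 0, \<dots>, W t\<close>.\<close>

lemma comp_bounded_UN_scales:
  fixes d :: "real \<Rightarrow> real"
  assumes d: "\<And>s. s > 0 \<Longrightarrow> d s \<ge> 0"
  shows "\<exists>s \<phi>. (\<forall>t. s t > 0) \<and> \<phi> \<ge> 0 \<and>
    (\<forall>r>0. \<forall>W :: nat \<Rightarrow> 'a::metric_space set.
      (\<forall>t\<le>n. comp_bounded (s t * r) (d (s t) * r) (W t)) \<longrightarrow>
      comp_bounded r (\<phi> * r) (\<Union>t\<le>n. W t))"
proof (induction n)
  case 0
  show ?case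
    by (intro exI[of _ "\<lambda>_. 1"] exI[of _ "d 1"]) (simp add: d)
next
  case (Suc n)
  then obtain s \<phi> where s: "\<And>t. s t > 0" and \<phi>: "\<phi> \<ge> 0"
    and IH: "\<And>r (W :: nat \<Rightarrow> 'a set). r > 0 \<Longrightarrow>
      (\<And>t. t \<le> n \<Longrightarrow> comp_bounded (s t * r) (d (s t) * r) (W t)) \<Longrightarrow>
      comp_bounded r (\<phi> * r) (\<Union>t\<le>n. W t)"
    by blast
  \<comment> \<open>With \<open>D = \<phi> * r\<close>, the scale \<open>D + 2 * r\<close> demanded
    by \<open>comp_bounded_Un\<close> is \<open>(\<phi> + 2) * r\<close>; \<open>\<phi>'\<close> is
    the resulting bound divided by \<open>r\<close>.\<close>
  define s' where "s' = s(Suc n := \<phi> + 2)"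
  define \<phi>' where "\<phi>' = d (\<phi> + 2) + 2 * (\<phi> + 1)"
  have "comp_bounded r (\<phi>' * r) (\<Union>t\<le>Suc n. W t)"
    if "r > 0" and W: "\<forall>t\<le>Suc n. comp_bounded (s' t * r) (d (s' t) * r) (W t)"
    for r and W :: "nat \<Rightarrow> 'a set"
  proof -
    have W': "comp_bounded (s t * r) (d (s t) * r) (W t)" if "t \<le> n" for t
      using W[rule_format, of t] that by (simp add: s'_def)
    have "comp_bounded (\<phi> * r + 2 * r) (d (\<phi> + 2) * r) (W (Suc n))"
      using W[rule_format, of "Suc n"] by (simp add: s'_def algebra_simps)
    from comp_bounded_Un[OF IH[OF \<open>r > 0\<close> W'] this]
    have "comp_bounded r (d (\<phi> + 2) * r + 2 * (\<phi> * r + r)) ((\<Union>t\<le>n. W t) \<union> W (Suc n))"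
      using \<open>r > 0\<close> \<phi> d[of "\<phi> + 2"] by simp
    moreover have "d (\<phi> + 2) * r + 2 * (\<phi> * r + r) = \<phi>' * r"
      by (simp add: \<phi>'_def algebra_simps)
    ultimately show ?thesis
      by (simp add: atMost_Suc Un_commute)
  qed
  moreover have "s' t > 0" for t
    using s \<phi> by (simp add: s'_def)
  moreover have "\<phi>' \<ge> 0"
    using \<phi> d[of "\<phi> + 2"] by (simp add: \<phi>'_def)
  ultimately show ?case by blast
qed

section \<open>The Hurewicz inequality\<close>

text \<open>By the Lipschitz condition an \<open>r\<close>-chain maps to an
  \<open>L * r\<close>-chain, so a chain over \<open>A\<close> stays over a single component of
  \<open>A\<close>, which has diameter at most \<open>R\<close>.\<close>

lemma comp_bounded_preimage:
  fixes f :: "'a::metric_space \<Rightarrow> 'b::metric_space"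
  assumes L: "L-lipschitz_on UNIV f"
    and A: "comp_bounded (L * r) R A"
    and Z: "\<And>C. diam_le C R \<Longrightarrow> comp_bounded r D (Z \<inter> f -` C)"
  shows "comp_bounded r D (Z \<inter> f -` A)"
  unfolding comp_bounded_def
proof (intro ballI allI impI)
  fix x y assume x: "x \<in> Z \<inter> f -` A" and xy: "(x, y) \<in> (linked r (Z \<inter> f -` A))\<^sup>*"
  define C where "C = r_component A (L * r) (f x)"
  have "diam_le C R"
    using A x by (simp add: C_def comp_bounded_iff_r_component)
  have x': "x \<in> Z \<inter> f -` C"
    using x by (simp add: C_def r_component_eq)
  from xy have "(x, y) \<in> (linked r (Z \<inter> f -` C))\<^sup>*"
  proof (induction rule: rtrancl_induct)
    case (step y z)
    have y: "y \<in> Z \<inter> f -` C"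
      using step.IH x' linked_rtrancl_in by blast
    have yz: "y \<in> Z" "f y \<in> A" "z \<in> Z" "f z \<in> A" "dist y z \<le> r"
      using step.hyps by (auto simp: linked_def)
    have "dist (f y) (f z) \<le> L * r"
      using lipschitz_onD[OF L, of y z] lipschitz_on_nonneg[OF L] yz(5)
      by (meson UNIV_I mult_left_mono order_trans)
    then have "(f y, f z) \<in> linked (L * r) A"
      using yz by (simp add: linked_def)
    then have "z \<in> Z \<inter> f -` C"
      using y yz by (auto simp: C_def r_component_eq)
    then have "(y, z) \<in> linked r (Z \<inter> f -` C)"
      using y yz by (simp add: linked_def)
    then show ?case
      using step.IH by (rule rtrancl_into_rtrancl[rotated])
  qed simp
  then show "dist x y \<le> D"
    using Z[OF \<open>diam_le C R\<close>] x' comp_boundedD by blast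
qed

text \<open>All scales are multiples of \<open>r\<close> by factors independent of \<open>r\<close>;
  this makes the resulting control function linear.\<close>

lemma space_control_function_domain:
  fixes f :: "'a::metric_space \<Rightarrow> 'b::metric_space"
  assumes lip: "L-lipschitz_on UNIV f" and "L > 0"
    and f: "map_control_function m (\<lambda>rX RY. a * rX + b * RY) f" and ab: "a \<ge> 0" "b \<ge> 0"
    and Y: "space_control_function n (\<lambda>r. c * r) TYPE('b)" and "c > 0"
  shows "\<exists>c'>0. space_control_function (m + n) (\<lambda>r. c' * r) TYPE('a)"
proof -
  define k where "k = Suc (m + n)"
  \<comment> \<open>\<open>e * r\<close> bounds the components of the sets \<open>A i\<close> at
    scale \<open>L * r\<close>.\<close>
  define e where "e = (2 * c + 1) * 3 ^ m * L"
  \<comment> \<open>\<open>d s * r\<close> is the bound of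
    \<open>map_control_function_multi_cover\<close> at scale \<open>s * r\<close> over members of
    diameter at most \<open>c * (e + 1) * r\<close>.\<close>
  define d where "d s = (a + 1) * 3 ^ n * s + b * (c * (e + 1))" for s :: real
  have "e > 0"
    using \<open>c > 0\<close> \<open>L > 0\<close> by (simp add: e_def)
  have "d s \<ge> 0" if "s > 0" for s
    using that ab \<open>c > 0\<close> \<open>e > 0\<close> by (simp add: d_def)
  then obtain s \<phi> where s: "\<And>t :: nat. s t > 0" and "\<phi> \<ge> 0"
    and W: "\<And>r (W :: nat \<Rightarrow> 'a set). r > 0 \<Longrightarrow>
      (\<And>t. t \<le> n \<Longrightarrow> comp_bounded (s t * r) (d (s t) * r) (W t)) \<Longrightarrow>
      comp_bounded r (\<phi> * r) (\<Union>t\<le>n. W t)"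
    using comp_bounded_UN_scales[of d n, where ?'a = 'a] by blast
  \<comment> \<open>\<open>\<phi>\<close> may be zero, whereas the coefficient must be positive;
    hence \<open>\<phi> + 1\<close>.\<close>
  have "space_control_function (m + n) (\<lambda>r. (\<phi> + 1) * r) TYPE('a)"
  proof (rule space_control_functionI)
    fix r :: real assume "r > 0"
    \<comment> \<open>\<open>S\<close> exceeds \<open>e * r\<close>, so a component of
      \<open>A i\<close> meets at most one member of an \<open>S\<close>-disjoint family.\<close>
    define S where "S = (e + 1) * r"
    have "S > 0" using \<open>r > 0\<close> \<open>e > 0\<close> by (simp add: S_def)
    have "L * r > 0" using \<open>r > 0\<close> \<open>L > 0\<close> by simp
    then obtain A :: "nat \<Rightarrow> 'b set"
      where A: "multi_cover (Suc n + m) (Suc m) A UNIV"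
        "\<And>i. i < Suc n + m \<Longrightarrow> comp_bounded (L * r) ((2 * c + 1) * 3 ^ m * (L * r)) (A i)"
      using space_control_function_multi_cover[OF Y] by blast
    obtain U :: "nat \<Rightarrow> 'b set set"
      where U: "\<And>t. t \<le> n \<Longrightarrow> r_disjoint S (U t)"
        "\<And>t C. t \<le> n \<Longrightarrow> C \<in> U t \<Longrightarrow> diam_le C (c * S)"
        "(\<Union>t\<le>n. \<Union>(U t)) = UNIV"
      using Y \<open>S > 0\<close> unfolding space_control_function_def by meson
    define good where "good t C Z \<longleftrightarrow> multi_cover k (Suc n) Z (f -` C) \<and>
        (\<forall>i<k. comp_bounded (s t * r) (d (s t) * r) (Z i))" for t C Z
    have "\<exists>Z. good t C Z" if "t \<le> n" "C \<in> U t" for t C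
    proof -
      have "c * S > 0" "s t * r > 0"
        using \<open>c > 0\<close> \<open>S > 0\<close> s \<open>r > 0\<close> by auto
      moreover have "(a + 1) * 3 ^ n * (s t * r) + b * (c * S) = d (s t) * r"
        by (simp add: d_def S_def algebra_simps)
      ultimately show ?thesis
        using map_control_function_multi_cover[OF f U(2)[OF that], of "s t * r" n]
        by (simp add: k_def good_def)
    qed
    then obtain Z where "\<And>t C. t \<le> n \<Longrightarrow> C \<in> U t \<Longrightarrow> good t C (Z t C)"
      by metis
    then have Z: "multi_cover k (Suc n) (Z t C) (f -` C)"
      "i < k \<Longrightarrow> comp_bounded (s t * r) (d (s t) * r) (Z t C i)" if "t \<le> n" "C \<in> U t" for t C i
      using that unfolding good_def by blast+
    \<comment> \<open>These are the sets \<open>Z i\<close> of the overview; here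
      \<open>Z t C i\<close> is the contribution of a single member \<open>C\<close>.\<close>
    define G where "G i = (\<Union>t\<le>n. \<Union>C\<in>U t. Z t C i)" for i
    have fiber: "comp_bounded r (\<phi> * r) (G i \<inter> f -` C')" if "i < k" "diam_le C' (e * r)" for i C'
    proof -
      \<comment> \<open>Only members meeting \<open>C'\<close> matter over \<open>C'\<close>, so
        \<open>V t\<close> is empty or lies in a single \<open>Z t C i\<close>.\<close>
      define V where "V t = (\<Union>C\<in>{C\<in>U t. C \<inter> C' \<noteq> {}}. Z t C i)" for t
      have "comp_bounded (s t * r) (d (s t) * r) (V t)" if "t \<le> n" for t
      proof (cases "\<exists>C\<in>U t. C \<inter> C' \<noteq> {}")
        case True
        then obtain C where C: "C \<in> U t" "C \<inter> C' \<noteq> {}" by blast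
        have "C2 = C" if C2: "C2 \<in> U t" "C2 \<inter> C' \<noteq> {}" for C2
        proof (rule ccontr)
          assume "C2 \<noteq> C"
          from C C2 obtain y y2 where "y \<in> C" "y \<in> C'" "y2 \<in> C2" "y2 \<in> C'" by blast
          then have "S \<le> dist y2 y" "dist y2 y \<le> e * r"
            using U(1)[OF \<open>t \<le> n\<close>] C C2 \<open>C2 \<noteq> C\<close> \<open>diam_le C' (e * r)\<close>
            by (auto simp: r_disjoint_def diam_le_def)
          then show False using \<open>r > 0\<close> by (simp add: S_def algebra_simps)
        qed
        then have "V t \<subseteq> Z t C i" by (auto simp: V_def)
        then show ?thesis
          using Z(2)[OF \<open>t \<le> n\<close> C(1) \<open>i < k\<close>] comp_bounded_mono by blast
      next
        case False
        then have "V t = {}" by (auto simp: V_def)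
        then show ?thesis by simp
      qed
      then have "comp_bounded r (\<phi> * r) (\<Union>t\<le>n. V t)"
        using W \<open>r > 0\<close> by blast
      moreover have "G i \<inter> f -` C' \<subseteq> (\<Union>t\<le>n. V t)"
      proof
        fix x assume "x \<in> G i \<inter> f -` C'"
        then obtain t C where x: "t \<le> n" "C \<in> U t" "x \<in> Z t C i" "f x \<in> C'"
          by (auto simp: G_def)
        then have "f x \<in> C"
          using Z(1)[of t C] \<open>i < k\<close> by (auto simp: multi_cover_def)
        with x show "x \<in> (\<Union>t\<le>n. V t)" by (auto simp: V_def)
      qed
      ultimately show ?thesis
        using comp_bounded_mono by blast
    qed
    have bound: "comp_bounded r ((\<phi> + 1) * r) (G i \<inter> f -` A i)" if "i \<le> m + n" for i
    proof -
      have "comp_bounded (L * r) (e * r) (A i)"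
        using A(2)[of i] that by (simp add: e_def mult.assoc)
      then have "comp_bounded r (\<phi> * r) (G i \<inter> f -` A i)"
        by (rule comp_bounded_preimage[OF lip]) (use that fiber in \<open>simp add: k_def\<close>)
      then show ?thesis
        using \<open>r > 0\<close> by (auto intro: comp_bounded_mono)
    qed
    have "x \<in> (\<Union>i\<le>m + n. G i \<inter> f -` A i)" for x
    proof -
      obtain t C where tC: "t \<le> n" "C \<in> U t" "f x \<in> C"
        using U(3) by (metis UNIV_I UN_E UnionE atMost_iff)
      \<comment> \<open>Pigeonhole: \<open>P\<close> and \<open>Q\<close> lie below
        \<open>k = m + n + 1\<close> and have at least \<open>n + 1\<close> and \<open>m + 1\<close>
        elements, so they share an index.\<close>
      define P where "P = {i. i < k \<and> x \<in> Z t C i}"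
      define Q where "Q = {i. i < k \<and> f x \<in> A i}"
      have "card P \<ge> Suc n"
        using Z(1)[OF tC(1,2)] tC(3) by (auto simp: multi_cover_def P_def)
      moreover have "card Q \<ge> Suc m"
        using A(1) by (auto simp: multi_cover_def Q_def k_def add.commute)
      moreover have fin: "finite P" "finite Q"
        by (auto simp: P_def Q_def)
      moreover have "card (P \<union> Q) \<le> card {..<k}"
        by (rule card_mono) (auto simp: P_def Q_def)
      moreover have "card P + card Q = card (P \<union> Q) + card (P \<inter> Q)"
        using fin by (rule card_Un_Int)
      ultimately have "P \<inter> Q \<noteq> {}"
        by (auto simp: k_def)
      then obtain i where "i < k" "x \<in> Z t C i" "f x \<in> A i"
        by (auto simp: P_def Q_def)
      then show ?thesis
        using tC by (auto simp: G_def k_def less_Suc_eq_le)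
    qed
    then have "(\<Union>i\<le>m + n. G i \<inter> f -` A i) = UNIV"
      by blast
    with bound show "\<exists>X :: nat \<Rightarrow> 'a set.
        (\<forall>i\<le>m + n. comp_bounded r ((\<phi> + 1) * r) (X i)) \<and> (\<Union>i\<le>m + n. X i) = UNIV"
      by (intro exI[of _ "\<lambda>i. G i \<inter> f -` A i"]) simp
  qed
  then show ?thesis
    using \<open>\<phi> \<ge> 0\<close> by (intro exI[of _ "\<phi> + 1"]) auto
qed

section \<open>From control functions to dimensions\<close>

text \<open>The empty set has infimum \<open>\<infinity>\<close>, and a nonempty set of extended
  naturals contains its infimum by well-ordering.\<close>

lemma Inf_enat_attained:
  assumes "Inf (enat ` N) \<noteq> \<infinity>"
  shows "\<exists>n\<in>N. Inf (enat ` N) = enat n"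
proof -
  have "N \<noteq> {}"
  proof
    assume "N = {}"
    with assms show False
      by (simp add: Inf_enat_def)
  qed
  then obtain k where "k \<in> N" by blast
  then have "Inf (enat ` N) \<in> enat ` N"
    by (intro wellorder_InfI[of "enat k"] imageI)
  then show ?thesis
    by (simp add: image_iff)
qed

theorem mainTheorem4:
  fixes f :: "'a::metric_space \<Rightarrow> 'b::metric_space"
  assumes "\<exists>C. C-lipschitz_on UNIV f"
  shows "asdim_space TYPE('a) \<le> asdim_map f + asdim_space TYPE('b)"
proof (cases "asdim_map f = \<infinity> \<or> asdim_space TYPE('b) = \<infinity>")
  case True
  then show ?thesis by auto
next
  case False
  define M where "M = {m. \<exists>a b. 0 \<le> a \<and> 0 \<le> b \<and>
      map_control_function m (\<lambda>rX RY. a * rX + b * RY) f}"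
  define N where "N = {n. \<exists>c>0. space_control_function n (\<lambda>r. c * r) TYPE('b)}"
  have M: "asdim_map f = Inf (enat ` M)"
    unfolding asdim_map_def M_def setcompr_eq_image ..
  have N: "asdim_space TYPE('b) = Inf (enat ` N)"
    unfolding asdim_space_def N_def setcompr_eq_image ..
  obtain m where "m \<in> M" and m: "asdim_map f = enat m"
    using False Inf_enat_attained[of M] unfolding M by blast
  then obtain a b where f: "0 \<le> a" "0 \<le> b"
    "map_control_function m (\<lambda>rX RY. a * rX + b * RY) f"
    unfolding M_def by blast
  obtain n where "n \<in> N" and n: "asdim_space TYPE('b) = enat n"
    using False Inf_enat_attained[of N] unfolding N by blast
  then obtain c where c: "c > 0" "space_control_function n (\<lambda>r. c * r) TYPE('b)"
    unfolding N_def by blast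
  obtain C where "C-lipschitz_on UNIV f"
    using assms by blast
  \<comment> \<open>The maximum makes the Lipschitz constant positive, as the scale
    \<open>L * r\<close> must be.\<close>
  then have "(max C 1)-lipschitz_on UNIV f"
    by (rule lipschitz_on_le) simp
  then have "\<exists>c'>0. space_control_function (m + n) (\<lambda>r. c' * r) TYPE('a)"
    using f c by (intro space_control_function_domain[of "max C 1" f m a b]) auto
  then have "asdim_space TYPE('a) \<le> enat (m + n)"
    unfolding asdim_space_def by (intro Inf_lower) blast
  then show ?thesis
    by (simp add: m n)
qed

end
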